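(* (i) If $\phi\in L^1_{loc}(\mathbb J,X)$ and $\Delta_h\phi\in C_{ub}(\mathbb J,X)$ for all $0<h\le\varepsilon_0$, for some $\varepsilon_0>0$, then $\phi$ is uniformly continuous. (ii) If $\phi\in L^1_{loc}(\mathbb J,X)$ and $\Delta_h\phi\in C_u(\mathbb J,X)$ for all $h>0$, then $\|(\Delta_h\phi)/w\|_\infty\to0$ as $h\to0$ (with $h>0$), where $w(t)=1+|t|$. (iii) $C_u(\mathbb J,X)$ endowed with $$\|f\|_u:=\|f/w\|_\infty+\sup_{t\in[0,1]}\|f-f_t\|_\infty,\qquad w(t)=1+|t|,$$ is a Banach space.
   Context: $X$ is a Banach space; $\mathbb J$ is an interval of the form $\mathbb R$, $(\alpha,\infty)$ or $[\alpha,\infty)$, $\alpha\in\mathbb R$. $f_t(s)=f(s+t)$, $\Delta_hf=f_h-f$, $\|f\|_\infty=\sup_{s\in\mathbb J}\|f(s)\|$. $C_u(\mathbb J,X)$: uniformly continuous functions $\mathbb J\to X$; $C_{ub}(\mathbb J,X)$: bounded uniformly continuous functions. $L^1_{loc}(\mathbb J,X)$: locally Bochner integrable functions (actual functions, not equivalence classes). *)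

theory Defs
  imports "HOL-Analysis.Analysis" "HOL-Library.Function_Algebras"
begin

text \<open>
  A function from an interval \<open>J\<close> to a Banach space is represented by a total function on the
  reals of which only the values on \<open>J\<close> matter. Where functions on \<open>J\<close> must be the elements of
  a vector space (\<open>Cu_space\<close> below), the representative vanishing outside \<open>J\<close> is chosen.
\<close>

definition admissible_interval :: "real set \<Rightarrow> bool" where
  "admissible_interval J \<longleftrightarrow> J = UNIV \<or> (\<exists>\<alpha>. J = {\<alpha><..} \<or> J = {\<alpha>..})"

text \<open>
  The integral of the library assumes a second-countable range. For an arbitrary Banach space,
  Bochner integrability is defined through approximation by integrable simple functions. The
  measure should be complete, so that \<open>norm (f x - s n x)\<close> is measurable by the second condition.
\<close>

definition bochner_integrable :: "'b measure \<Rightarrow> ('b \<Rightarrow> 'a::banach) \<Rightarrow> bool" where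
  "bochner_integrable M f \<longleftrightarrow>
     (\<exists>s. (\<forall>n. Bochner_Integration.simple_bochner_integrable M (s n)) \<and>
          (AE x in M. (\<lambda>n. s n x) \<longlonglongrightarrow> f x) \<and>
          (\<lambda>n. \<integral>\<^sup>+x. ennreal (norm (f x - s n x)) \<partial>M) \<longlonglongrightarrow> 0)"

definition L1_loc :: "real set \<Rightarrow> (real \<Rightarrow> 'a::banach) set" where
  "L1_loc J = {f. \<forall>K. compact K \<and> K \<subseteq> J \<longrightarrow> bochner_integrable (lebesgue_on K) f}"

definition Cu :: "real set \<Rightarrow> (real \<Rightarrow> 'a::banach) set" where
  "Cu J = {f. uniformly_continuous_on J f}"

definition Cub :: "real set \<Rightarrow> (real \<Rightarrow> 'a::banach) set" where
  "Cub J = {f \<in> Cu J. bounded (f ` J)}"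

definition translate :: "real \<Rightarrow> (real \<Rightarrow> 'a) \<Rightarrow> real \<Rightarrow> 'a" where
  "translate t f = (\<lambda>s. f (s + t))"

definition difference :: "real \<Rightarrow> (real \<Rightarrow> 'a::banach) \<Rightarrow> real \<Rightarrow> 'a" where
  "difference h f = (\<lambda>s. translate h f s - f s)"

definition weight :: "real \<Rightarrow> real" where
  "weight t = 1 + \<bar>t\<bar>"

text \<open>Extended-valued, so that the supremum is meaningful for unbounded functions.\<close>

definition sup_norm :: "real set \<Rightarrow> (real \<Rightarrow> 'a::banach) \<Rightarrow> ennreal" where
  "sup_norm J f = (SUP s\<in>J. ennreal (norm (f s)))"

definition u_norm :: "real set \<Rightarrow> (real \<Rightarrow> 'a::banach) \<Rightarrow> ennreal" where
  "u_norm J f = sup_norm J (\<lambda>s. f s /\<^sub>R weight s)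
                + (SUP t\<in>{0..1}. sup_norm J (\<lambda>s. f s - translate t f s))"

definition Cu_space :: "real set \<Rightarrow> (real \<Rightarrow> 'a::banach) set" where
  "Cu_space J = {f \<in> Cu J. \<forall>s. s \<notin> J \<longrightarrow> f s = 0}"

text \<open>
  A linear subspace \<open>V\<close> of a real vector space with scalar multiplication \<open>sc\<close> is a Banach
  space under the norm \<open>N\<close>. The norm axioms concern \<open>V\<close> only; \<open>Metric_space\<close> asks in addition that
  \<open>N (f - g)\<close> be nonnegative and symmetric off \<open>V\<close>, and makes \<open>mcomplete\<close> meaningful.
\<close>

definition banach_space_on ::
    "'v::ab_group_add set \<Rightarrow> (real \<Rightarrow> 'v \<Rightarrow> 'v) \<Rightarrow> ('v \<Rightarrow> real) \<Rightarrow> bool" where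
  "banach_space_on V sc N \<longleftrightarrow>
     vector_space sc \<and> module.subspace sc V \<and>
     (\<forall>f\<in>V. 0 \<le> N f \<and> (N f = 0 \<longleftrightarrow> f = 0)) \<and>
     (\<forall>c. \<forall>f\<in>V. N (sc c f) = \<bar>c\<bar> * N f) \<and>
     (\<forall>f\<in>V. \<forall>g\<in>V. N (f + g) \<le> N f + N g) \<and>
     Metric_space V (\<lambda>f g. N (f - g)) \<and>
     Metric_space.mcomplete V (\<lambda>f g. N (f - g))"

end

theory Submission
  imports Defs
begin

text \<open>
  The first two parts rest on one estimate, \<open>differences_small\<close>: if every difference of \<open>\<phi>\<close> with step
  \<open>h \<le> e\<close> is uniformly continuous and bounded by a multiple of a weight \<open>W \<ge> 1\<close>, then its quotient by
  \<open>W\<close> tends to zero uniformly as \<open>h\<close> decreases to \<open>0\<close>. With \<open>W = 1\<close> this is uniform continuity of \<open>\<phi>\<close>. With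
  \<open>W\<close> the function \<^const>\<open>weight\<close> it is the second part, since uniformly continuous functions on an
  interval grow at most linearly (\<open>uniformly_continuous_linear_growth\<close>).

  The estimate turns measurability of \<open>\<phi>\<close> into uniformity in the step. For each \<open>n\<close> the steps
  \<open>h\<close> whose difference is bounded by \<open>n * W\<close> and has modulus of continuity \<open>1 / (n + 1)\<close> for a given
  accuracy form a measurable set. These sets increase to \<open>{0<..e}\<close>, so one of them fills more than half
  of it and meets all its small translates. Writing a small step as the difference of two steps
  in that set makes bound and modulus uniform for small steps (\<open>differences_locally_bounded\<close>). Hence
  the map from steps to differences is bounded and almost additive near zero, and repeated
  halving of the step turns boundedness into smallness.

  In the third part the norm controls growth and unit shifts. A Cauchy sequence converges pointwise,
  and the shift part of the norm transfers uniform continuity to the limit.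
\<close>

section \<open>Functions approximable by simple functions\<close>

text \<open>
  This is Bochner measurability. In a nonseparable space differences of Borel measurable functions
  need not be Borel measurable, so closure under differences has to come from approximation by
  simple functions; only norms are ever shown to be Borel measurable.
\<close>
definition strongly_measurable :: "(real \<Rightarrow> 'a::banach) \<Rightarrow> bool" where
  "strongly_measurable f \<longleftrightarrow>
     (\<exists>u. (\<forall>n. simple_function lebesgue (u n)) \<and> (AE x in lebesgue. (\<lambda>n. u n x) \<longlonglongrightarrow> f x))"

lemma strongly_measurable_diff:
  assumes "strongly_measurable f" "strongly_measurable g"
  shows "strongly_measurable (\<lambda>x. f x - g x)"
proof -
  obtain u v where u: "\<And>n. simple_function lebesgue (u n)" "AE x in lebesgue. (\<lambda>n. u n x) \<longlonglongrightarrow> f x"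
    and v: "\<And>n. simple_function lebesgue (v n)" "AE x in lebesgue. (\<lambda>n. v n x) \<longlonglongrightarrow> g x"
    using assms unfolding strongly_measurable_def by blast
  have "simple_function lebesgue (\<lambda>x. u n x - v n x)" for n
    using u(1)[of n] v(1)[of n] by (rule simple_function_compose2)
  moreover have "AE x in lebesgue. (\<lambda>n. u n x - v n x) \<longlonglongrightarrow> f x - g x"
    using u(2) v(2) by eventually_elim (rule tendsto_diff)
  ultimately show ?thesis
    unfolding strongly_measurable_def by (intro exI[of _ "\<lambda>n x. u n x - v n x"]) auto
qed

lemma strongly_measurable_shift:
  assumes "strongly_measurable f"
  shows "strongly_measurable (\<lambda>x. f (a + x))"
proof -
  obtain u where u: "\<And>n. simple_function lebesgue (u n)" "AE x in lebesgue. (\<lambda>n. u n x) \<longlonglongrightarrow> f x"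
    using assms unfolding strongly_measurable_def by blast
  have T: "(\<lambda>x. a + x) \<in> measurable lebesgue lebesgue"
  proof (rule measurableI)
    fix B :: "real set" assume "B \<in> sets lebesgue"
    moreover have "(\<lambda>x. a + x) -` B \<inter> space lebesgue = (\<lambda>x. - a + x) ` B"
      by (force simp: image_iff)
    ultimately show "(\<lambda>x. a + x) -` B \<inter> space lebesgue \<in> sets lebesgue"
      by (simp only: lebesgue_sets_translation)
  qed auto
  have "simple_function lebesgue (\<lambda>x. u n (a + x))" for n
    by (rule simple_function_comp[OF T u(1)])
  moreover have "AE x in lebesgue. (\<lambda>n. u n (a + x)) \<longlonglongrightarrow> f (a + x)"
  proof -
    obtain N where N: "N \<in> null_sets lebesgue" "{x. \<not> (\<lambda>n. u n x) \<longlonglongrightarrow> f x} \<subseteq> N"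
      using u(2) unfolding eventually_ae_filter by auto
    have "negligible ((+) (- a) ` N)"
      using N(1) by (intro negligible_translation) (simp add: negligible_iff_null_sets)
    then have "(+) (- a) ` N \<in> null_sets lebesgue"
      by (simp add: negligible_iff_null_sets)
    moreover have "x \<in> (+) (- a) ` N" if "\<not> (\<lambda>n. u n (a + x)) \<longlonglongrightarrow> f (a + x)" for x
      using N(2) that by (intro image_eqI[where x = "a + x"]) auto
    then have "{x \<in> space lebesgue. \<not> (\<lambda>n. u n (a + x)) \<longlonglongrightarrow> f (a + x)} \<subseteq> (+) (- a) ` N"
      by auto
    ultimately show ?thesis unfolding eventually_ae_filter by blast
  qed
  ultimately show ?thesis
    unfolding strongly_measurable_def by (intro exI[of _ "\<lambda>n x. u n (a + x)"]) auto
qed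

lemma strongly_measurable_norm:
  assumes "strongly_measurable f"
  shows "(\<lambda>x. norm (f x)) \<in> borel_measurable lebesgue"
proof -
  obtain u where u: "\<And>n. simple_function lebesgue (u n)" "AE x in lebesgue. (\<lambda>n. u n x) \<longlonglongrightarrow> f x"
    using assms unfolding strongly_measurable_def by blast
  have m: "(\<lambda>x. norm (u n x)) \<in> borel_measurable lebesgue" for n
    using simple_function_compose1[OF u(1), of norm] by (rule borel_measurable_simple_function)
  have "(\<lambda>x. lim (\<lambda>n. norm (u n x))) \<in> borel_measurable lebesgue"
    using m by (rule borel_measurable_lim_metric)
  moreover have "AE x in lebesgue. lim (\<lambda>n. norm (u n x)) = norm (f x)"
    using u(2) by eventually_elim (intro limI tendsto_norm)
  ultimately show ?thesis by (rule borel_measurable_AE)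
qed

text \<open>
  Only approximability is retained from local integrability. Extension by zero turns functions on
  compact subsets into functions on the whole line, which can be translated.
\<close>
lemma L1_loc_strongly_measurable:
  assumes "\<phi> \<in> L1_loc J" "compact K" "K \<subseteq> J"
  shows "strongly_measurable (\<lambda>x. if x \<in> K then \<phi> x else 0)"
proof -
  have K: "K \<in> sets lebesgue" using assms(2) by (simp add: borel_compact)
  have "bochner_integrable (lebesgue_on K) \<phi>"
    using assms by (simp add: L1_loc_def)
  then obtain s where s_all: "(\<forall>n. Bochner_Integration.simple_bochner_integrable (lebesgue_on K) (s n)) \<and>
      (AE x in lebesgue_on K. (\<lambda>n. s n x) \<longlonglongrightarrow> \<phi> x) \<and>
      (\<lambda>n. \<integral>\<^sup>+x. ennreal (norm (\<phi> x - s n x)) \<partial>(lebesgue_on K)) \<longlonglongrightarrow> 0"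
    unfolding bochner_integrable_def by (rule exE)
  then have s: "\<And>n. Bochner_Integration.simple_bochner_integrable (lebesgue_on K) (s n)"
    and lim: "AE x in lebesgue_on K. (\<lambda>n. s n x) \<longlonglongrightarrow> \<phi> x"
    by simp_all
  define u where "u = (\<lambda>n x. if x \<in> K then s n x else 0)"
  have "simple_function lebesgue (u n)" for n
  proof -
    have sn: "simple_function (lebesgue_on K) (s n)"
      using s[of n] by (auto elim: Bochner_Integration.simple_bochner_integrable.cases)
    have "finite (insert 0 (s n ` K))"
      using simple_functionD(1)[OF sn] by simp
    then have fin: "finite (u n ` space lebesgue)"
      by (rule rev_finite_subset) (auto simp: u_def)
    have "u n -` {y} \<inter> space lebesgue \<in> sets lebesgue" for y
    proof -
      have "s n -` {y} \<inter> K \<in> sets lebesgue"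
        using simple_functionD(2)[OF sn, of "{y}"] K by (simp add: sets_restrict_space_iff)
      moreover have "u n -` {y} \<inter> space lebesgue = (s n -` {y} \<inter> K) \<union> (if y = 0 then - K else {})"
        by (auto simp: u_def split: if_splits)
      moreover have "- K \<in> sets lebesgue" using K by (rule Compl_in_sets_lebesgue[THEN iffD2])
      ultimately show ?thesis by auto
    qed
    with fin show ?thesis unfolding simple_function_def by blast
  qed
  moreover have "AE x in lebesgue. (\<lambda>n. u n x) \<longlonglongrightarrow> (if x \<in> K then \<phi> x else 0)"
  proof -
    have "AE x in lebesgue. x \<in> K \<longrightarrow> (\<lambda>n. s n x) \<longlonglongrightarrow> \<phi> x"
      using lim K by (simp add: AE_restrict_space_iff)
    then show ?thesis by eventually_elim (auto simp: u_def)
  qed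
  ultimately show ?thesis unfolding strongly_measurable_def by blast
qed

section \<open>Measurable sets of steps\<close>

text \<open>
  By separability of \<open>S\<close> and continuity of each \<open>g h\<close> the uncountable intersection over \<open>S\<close>
  equals one over a countable dense subset.
\<close>
lemma sets_Collect_ball_continuous:
  fixes g :: "real \<Rightarrow> 'b::euclidean_space \<Rightarrow> real"
  assumes cont: "\<And>h. h \<in> I \<Longrightarrow> continuous_on S (g h)"
    and meas: "\<And>x. x \<in> S \<Longrightarrow> {h \<in> I. g h x \<le> 0} \<in> sets M" and I: "I \<in> sets M"
  shows "{h \<in> I. \<forall>x\<in>S. g h x \<le> 0} \<in> sets M"
proof -
  obtain T where T: "countable T" "T \<subseteq> S" "S \<subseteq> closure T"
    using separable by blast
  have "(\<forall>x\<in>S. g h x \<le> 0) \<longleftrightarrow> (\<forall>x\<in>T. g h x \<le> 0)" if "h \<in> I" for h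
  proof
    assume le: "\<forall>x\<in>T. g h x \<le> 0"
    have "closedin (top_of_set S) (S \<inter> g h -` {..0})"
      using cont[OF that] by (intro continuous_closedin_preimage) auto
    then obtain C where C: "closed C" "S \<inter> g h -` {..0} = S \<inter> C"
      by (auto simp: closedin_closed)
    have "T \<subseteq> C" using le T(2) C(2) by auto
    then have "S \<subseteq> C" using T(3) closure_minimal[OF _ C(1)] by blast
    then show "\<forall>x\<in>S. g h x \<le> 0" using C(2) by auto
  qed (use T in auto)
  then have "{h \<in> I. \<forall>x\<in>S. g h x \<le> 0} = I \<inter> (\<Inter>x\<in>T. {h \<in> I. g h x \<le> 0})" if "T \<noteq> {}"
    using that by auto
  moreover have "I \<inter> (\<Inter>x\<in>T. {h \<in> I. g h x \<le> 0}) \<in> sets M" if "T \<noteq> {}"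
    using that T meas I by (intro sets.Int sets.countable_INT') auto
  moreover have "S = {}" if "T = {}" using that T by auto
  ultimately show ?thesis using I by (cases "T = {}") auto
qed

text \<open>
  If \<open>A\<close> and its translate by \<open>- h\<close> were disjoint, their union would have measure
  \<open>2 * measure lebesgue A > e\<close> while lying in an interval of length \<open>e + h\<close>; this fails for small \<open>h\<close>.
\<close>
lemma meets_translates_of_large_set:
  fixes A :: "real set"
  assumes e: "0 < e" and A: "A \<in> sets lebesgue" "A \<subseteq> {0<..e}" and big: "measure lebesgue A > e / 2"
  shows "\<exists>\<eta>>0. \<forall>h. 0 < h \<and> h < \<eta> \<longrightarrow> (\<exists>c\<in>A. c + h \<in> A)"
proof (intro exI[of _ "2 * measure lebesgue A - e"] conjI allI impI)
  show "2 * measure lebesgue A - e > 0" using big by simp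
  fix h assume h: "0 < h \<and> h < 2 * measure lebesgue A - e"
  have Am: "A \<in> lmeasurable"
    using bounded_subset[OF _ A(2)] A(1) by (intro bounded_set_imp_lmeasurable) auto
  let ?B = "(+) (- h) ` A"
  have Bm: "?B \<in> lmeasurable" using Am by (rule measurable_translation)
  show "\<exists>c\<in>A. c + h \<in> A"
  proof (rule ccontr)
    assume none: "\<not> (\<exists>c\<in>A. c + h \<in> A)"
    have "A \<inter> ?B = {}"
      using none by force
    then have "measure lebesgue (A \<union> ?B) = measure lebesgue A + measure lebesgue ?B"
      using Am Bm by (intro measure_Un_AE AE_I2) auto
    also have "\<dots> = 2 * measure lebesgue A" by (simp only: measure_translation)
    finally have "measure lebesgue (A \<union> ?B) = 2 * measure lebesgue A" .
    have AB: "A \<subseteq> {-h..e}" "?B \<subseteq> {-h..e}"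
      using A(2) h by (force dest!: subsetD)+
    then have "measure lebesgue (A \<union> ?B) \<le> measure lebesgue {-h..e}"
      using Am Bm AB by (intro measure_mono_fmeasurable) auto
    with h e show False using \<open>measure lebesgue (A \<union> ?B) = 2 * measure lebesgue A\<close> by simp
  qed
qed

lemma difference_apply: "difference h f s = f (s + h) - f s"
  by (simp add: difference_def translate_def)

text \<open>
  Here \<open>h\<close> is the variable and \<open>s\<close> is fixed. Cutting off to \<open>{0..e}\<close> keeps the argument \<open>s + h\<close>
  in a compact part of the interval.
\<close>
lemma strongly_measurable_difference:
  assumes \<phi>: "\<phi> \<in> L1_loc J" and st: "{s..s + e} \<subseteq> J"
  shows "strongly_measurable (\<lambda>h. if h \<in> {0..e} then difference h \<phi> s else 0)"
proof -
  let ?f = "\<lambda>x. if x \<in> {s..s + e} then \<phi> x else 0"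
  let ?g = "\<lambda>h::real. if h \<in> {0..e} then \<phi> s else 0"
  have g: "strongly_measurable ?g"
  proof -
    have "{x \<in> space lebesgue. x \<in> {0..e}} \<in> sets lebesgue" by simp
    then have "simple_function lebesgue ?g"
      by (intro simple_function_If) auto
    then show ?thesis
      unfolding strongly_measurable_def by (intro exI[of _ "\<lambda>n. ?g"]) auto
  qed
  have "strongly_measurable ?f"
    using L1_loc_strongly_measurable[OF \<phi> _ st] by simp
  then have "strongly_measurable (\<lambda>h. ?f (s + h) - ?g h)"
    using g strongly_measurable_shift[of ?f s] by (intro strongly_measurable_diff)
  also have "(\<lambda>h. ?f (s + h) - ?g h) = (\<lambda>h. if h \<in> {0..e} then difference h \<phi> s else 0)"
    by (auto simp: difference_apply)
  finally show ?thesis .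
qed

section \<open>Differences with small steps\<close>

lemma admissible_interval_shift:
  assumes "admissible_interval J" "s \<in> J" "0 \<le> t"
  shows "s + t \<in> J"
  using assms by (auto simp: admissible_interval_def)

lemma admissible_interval_nonempty:
  assumes "admissible_interval J"
  obtains s where "s \<in> J"
proof -
  have "\<exists>s. s \<in> J"
    using assms unfolding admissible_interval_def
    by (elim disjE exE) (auto intro: gt_ex)
  then show ?thesis using that by (elim exE)
qed

lemma admissible_interval_Icc_subset:
  assumes "admissible_interval J" "s \<in> J"
  shows "{s..t} \<subseteq> J"
  using assms by (auto simp: admissible_interval_def)

text \<open>
  The second condition runs over pairs of points \<open>s < s + k\<close>; it is read as a condition on a subset
  of the plane so that the reduction to a countable dense set applies to it as well.
\<close>
lemma sets_tame_increments:
  fixes \<phi> :: "real \<Rightarrow> 'a::banach"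
  assumes J: "admissible_interval J" and \<phi>: "\<phi> \<in> L1_loc J"
    and W: "continuous_on J W"
    and cont: "\<And>h. 0 < h \<Longrightarrow> h \<le> e \<Longrightarrow> continuous_on J (difference h \<phi>)"
  shows "{h \<in> {0<..e}. (\<forall>s\<in>J. norm (difference h \<phi> s) \<le> b * W s) \<and>
            (\<forall>s\<in>J. \<forall>k. 0 < k \<and> k < \<delta> \<longrightarrow> norm (difference h \<phi> (s + k) - difference h \<phi> s) \<le> \<epsilon>)}
         \<in> sets lebesgue"
    (is "{h \<in> ?I. ?P h \<and> ?Q h} \<in> _")
proof -
  have D: "strongly_measurable (\<lambda>h. if h \<in> {0..e} then difference h \<phi> s else 0)" if "s \<in> J" for s
    using that by (intro strongly_measurable_difference[OF \<phi>] admissible_interval_Icc_subset[OF J])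
  have level: "{h \<in> ?I. f h \<le> c} \<in> sets lebesgue"
    if "g \<in> borel_measurable lebesgue" "\<And>h. h \<in> ?I \<Longrightarrow> g h = f h" for f g :: "real \<Rightarrow> real" and c
  proof -
    have "{h \<in> ?I. f h \<le> c} = {h \<in> space lebesgue. g h \<le> c} \<inter> ?I"
      using that(2) by auto
    moreover have "{h \<in> space lebesgue. g h \<le> c} \<in> sets lebesgue"
      by (rule borel_measurable_le[OF that(1)]) simp
    ultimately show ?thesis by (simp only:) (intro sets.Int, auto)
  qed
  have P: "{h \<in> ?I. \<forall>s\<in>J. norm (difference h \<phi> s) - b * W s \<le> 0} \<in> sets lebesgue"
  proof (rule sets_Collect_ball_continuous)
    show "continuous_on J (\<lambda>s. norm (difference h \<phi> s) - b * W s)" if "h \<in> ?I" for h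
      using that W cont by (intro continuous_intros) auto
    show "{h \<in> ?I. norm (difference h \<phi> s) - b * W s \<le> 0} \<in> sets lebesgue" if "s \<in> J" for s
    proof -
      have "{h \<in> ?I. norm (difference h \<phi> s) \<le> b * W s} \<in> sets lebesgue"
        by (rule level[OF strongly_measurable_norm[OF D[OF that]]]) auto
      then show ?thesis by simp
    qed
  qed simp
  define S where "S = {p. fst p \<in> J \<and> fst p < snd p \<and> snd p < fst p + \<delta>}"
  have snd_J: "snd p \<in> J" if "p \<in> S" for p
    using admissible_interval_shift[OF J, of "fst p" "snd p - fst p"] that by (simp add: S_def)
  have SJ: "fst ` S \<subseteq> J" "snd ` S \<subseteq> J"
    using snd_J by (simp_all add: image_subset_iff S_def)
  have Q: "{h \<in> ?I. \<forall>p\<in>S. norm (difference h \<phi> (snd p) - difference h \<phi> (fst p)) - \<epsilon> \<le> 0}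
           \<in> sets lebesgue"
  proof (rule sets_Collect_ball_continuous)
    show "continuous_on S (\<lambda>p. norm (difference h \<phi> (snd p) - difference h \<phi> (fst p)) - \<epsilon>)"
      if "h \<in> ?I" for h
    proof -
      have c: "continuous_on J (difference h \<phi>)" using that by (intro cont) auto
      have "continuous_on S (\<lambda>p. difference h \<phi> (snd p))" "continuous_on S (\<lambda>p. difference h \<phi> (fst p))"
        by (rule continuous_on_compose2[OF c _ SJ(2)] continuous_on_compose2[OF c _ SJ(1)],
            intro continuous_intros)+
      then show ?thesis by (intro continuous_intros)
    qed
    show "{h \<in> ?I. norm (difference h \<phi> (snd p) - difference h \<phi> (fst p)) - \<epsilon> \<le> 0} \<in> sets lebesgue"
      if "p \<in> S" for p
    proof -
      have p: "fst p \<in> J" "snd p \<in> J" using that SJ by auto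
      have "{h \<in> ?I. norm (difference h \<phi> (snd p) - difference h \<phi> (fst p)) \<le> \<epsilon>} \<in> sets lebesgue"
        by (rule level[OF strongly_measurable_norm[OF strongly_measurable_diff[OF D[OF p(2)] D[OF p(1)]]]])
          auto
      then show ?thesis by simp
    qed
  qed simp
  have "?Q h \<longleftrightarrow> (\<forall>p\<in>S. norm (difference h \<phi> (snd p) - difference h \<phi> (fst p)) - \<epsilon> \<le> 0)" for h
  proof
    assume q: "?Q h"
    show "\<forall>p\<in>S. norm (difference h \<phi> (snd p) - difference h \<phi> (fst p)) - \<epsilon> \<le> 0"
    proof
      fix p assume "p \<in> S"
      then show "norm (difference h \<phi> (snd p) - difference h \<phi> (fst p)) - \<epsilon> \<le> 0"
        using q[rule_format, of "fst p" "snd p - fst p"] by (auto simp: S_def)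
    qed
  next
    assume p: "\<forall>p\<in>S. norm (difference h \<phi> (snd p) - difference h \<phi> (fst p)) - \<epsilon> \<le> 0"
    show "?Q h"
    proof (intro ballI allI impI)
      fix s k assume "s \<in> J" "0 < k \<and> k < \<delta>"
      then show "norm (difference h \<phi> (s + k) - difference h \<phi> s) \<le> \<epsilon>"
        using p[rule_format, of "(s, s + k)"] by (simp add: S_def)
    qed
  qed
  then have "{h \<in> ?I. ?P h \<and> ?Q h} =
      {h \<in> ?I. \<forall>s\<in>J. norm (difference h \<phi> s) - b * W s \<le> 0} \<inter>
      {h \<in> ?I. \<forall>p\<in>S. norm (difference h \<phi> (snd p) - difference h \<phi> (fst p)) - \<epsilon> \<le> 0}"
    by auto
  then show ?thesis using sets.Int[OF P Q] by simp
qed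

text \<open>
  The bounds and moduli of continuity of the single differences depend on the step; measurability
  makes them uniform for small steps. The steps that admit the bound \<open>n * W\<close> and the modulus
  \<open>1 / (n + 1)\<close> for accuracy \<open>\<epsilon> / 2\<close> form measurable sets increasing to \<open>{0<..e}\<close>. For some \<open>n\<close> and
  all small \<open>h\<close>, the set therefore contains \<open>c\<close> and \<open>c + h\<close> for some \<open>c\<close> depending on \<open>h\<close>. Since
  \<open>\<phi> (s + h) - \<phi> s = (\<phi> (s + c + h) - \<phi> s) - (\<phi> (s + h + c) - \<phi> (s + h))\<close>, the properties pass to \<open>h\<close>.
  This decomposition uses only shifts to the right, which stay inside a half-line.
\<close>
lemma differences_locally_bounded:
  fixes \<phi> :: "real \<Rightarrow> 'a::banach"
  assumes J: "admissible_interval J" and \<phi>: "\<phi> \<in> L1_loc J"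
    and W: "continuous_on J W" "\<And>s. s \<in> J \<Longrightarrow> 0 \<le> W s"
      "\<And>s t. s \<in> J \<Longrightarrow> 0 \<le> t \<Longrightarrow> t \<le> 1 \<Longrightarrow> W (s + t) \<le> 2 * W s"
    and "0 < e"
    and unif: "\<And>h. 0 < h \<Longrightarrow> h \<le> e \<Longrightarrow> uniformly_continuous_on J (difference h \<phi>)"
    and bdd: "\<And>h. 0 < h \<Longrightarrow> h \<le> e \<Longrightarrow> \<exists>b. \<forall>s\<in>J. norm (difference h \<phi> s) \<le> b * W s"
    and "0 < \<epsilon>"
  obtains \<delta> b where "0 < \<delta>" "0 \<le> b"
    "\<And>h s. 0 < h \<Longrightarrow> h < \<delta> \<Longrightarrow> s \<in> J \<Longrightarrow> norm (difference h \<phi> s) \<le> b * W s"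
    "\<And>h k s. 0 < h \<Longrightarrow> h < \<delta> \<Longrightarrow> 0 < k \<Longrightarrow> k < \<delta> \<Longrightarrow> s \<in> J \<Longrightarrow>
       norm (difference h \<phi> (s + k) - difference h \<phi> s) \<le> \<epsilon>"
proof -
  define A where "A = (\<lambda>n. {h \<in> {0<..e}. (\<forall>s\<in>J. norm (difference h \<phi> s) \<le> real n * W s) \<and>
            (\<forall>s\<in>J. \<forall>k. 0 < k \<and> k < 1 / real (Suc n) \<longrightarrow>
               norm (difference h \<phi> (s + k) - difference h \<phi> s) \<le> \<epsilon> / 2)})"
  have A: "A n \<in> sets lebesgue" for n
    unfolding A_def using unif uniformly_continuous_imp_continuous
    by (intro sets_tame_increments[OF J \<phi> W(1)]) auto
  have A_mono: "A m \<subseteq> A n" if "m \<le> n" for m n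
  proof
    fix h assume h: "h \<in> A m"
    have "norm (difference h \<phi> s) \<le> real n * W s" if s: "s \<in> J" for s
    proof -
      have "norm (difference h \<phi> s) \<le> real m * W s" using h s by (simp add: A_def)
      also have "\<dots> \<le> real n * W s" using \<open>m \<le> n\<close> W(2)[OF s] by (intro mult_right_mono) auto
      finally show ?thesis .
    qed
    moreover have "k < 1 / real (Suc m)" if "k < 1 / real (Suc n)" for k
      using that by (rule less_le_trans) (use \<open>m \<le> n\<close> in \<open>simp add: frac_le\<close>)
    ultimately show "h \<in> A n" using h unfolding A_def by auto
  qed
  have A_union: "(\<Union>n. A n) = {0<..e}"
  proof
    show "{0<..e} \<subseteq> (\<Union>n. A n)"
    proof
      fix h assume h: "h \<in> {0<..e}"
      obtain b where b: "\<And>s. s \<in> J \<Longrightarrow> norm (difference h \<phi> s) \<le> b * W s"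
        using bdd[of h] h by auto
      obtain d where d: "0 < d"
        "\<And>s s'. s \<in> J \<Longrightarrow> s' \<in> J \<Longrightarrow> dist s' s < d \<Longrightarrow> dist (difference h \<phi> s') (difference h \<phi> s) < \<epsilon> / 2"
        using unif[of h] h \<open>0 < \<epsilon>\<close> unfolding uniformly_continuous_on_def
        by (metis greaterThanAtMost_iff half_gt_zero)
      obtain n1 :: nat where n1: "b \<le> real n1" using real_arch_simple by blast
      obtain n2 :: nat where n2: "1 / real (Suc n2) < d"
        using nat_approx_posE[OF d(1)] by blast
      define n where "n = max n1 n2"
      have "norm (difference h \<phi> s) \<le> real n * W s" if s: "s \<in> J" for s
      proof -
        have "b * W s \<le> real n * W s"
          using n1 W(2)[OF s] by (intro mult_right_mono) (auto simp: n_def)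
        with b[OF s] show ?thesis by simp
      qed
      moreover have "norm (difference h \<phi> (s + k) - difference h \<phi> s) \<le> \<epsilon> / 2"
        if "s \<in> J" "0 < k" "k < 1 / real (Suc n)" for s k
      proof -
        have "1 / real (Suc n) \<le> 1 / real (Suc n2)"
          by (intro divide_left_mono) (auto simp: n_def)
        then have "k < d" using that n2 by linarith
        then show ?thesis
          using d(2)[of s "s + k"] that admissible_interval_shift[OF J, of s k]
          by (auto simp: dist_norm)
      qed
      ultimately show "h \<in> (\<Union>n. A n)" using h unfolding A_def by blast
    qed
  qed (auto simp: A_def)
  have "(\<lambda>n. measure lebesgue (A n)) \<longlonglongrightarrow> measure lebesgue (\<Union>n. A n)"
    using A A_mono \<open>0 < e\<close> by (intro Lim_measure_incseq) (auto simp: incseq_def A_union)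
  moreover have "measure lebesgue (\<Union>n. A n) > e / 2"
    using \<open>0 < e\<close> by (simp add: A_union)
  ultimately have "\<forall>\<^sub>F n in sequentially. e / 2 < measure lebesgue (A n)"
    by (rule order_tendstoD)
  then obtain n where n: "e / 2 < measure lebesgue (A n)"
    by (auto simp: eventually_sequentially)
  obtain \<eta> where \<eta>: "0 < \<eta>" "\<And>h. 0 < h \<Longrightarrow> h < \<eta> \<Longrightarrow> \<exists>c\<in>A n. c + h \<in> A n"
  proof -
    have "A n \<subseteq> {0<..e}" by (auto simp: A_def)
    then show ?thesis using meets_translates_of_large_set[OF \<open>0 < e\<close> A[of n] _ n] that by blast
  qed
  \<comment> \<open>The cap at \<open>1\<close> is for the doubling bound on \<open>W\<close>, which covers shifts up to \<open>1\<close> only.\<close>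
  define \<delta> where "\<delta> = min (min \<eta> 1) (1 / real (Suc n))"
  have split: "difference h \<phi> s = difference (c + h) \<phi> s - difference c \<phi> (s + h)" for h s c
    by (simp add: difference_apply algebra_simps)
  show thesis
  proof (rule that[of \<delta> "3 * real n"])
    show "0 < \<delta>" using \<eta>(1) by (simp add: \<delta>_def)
    show "0 \<le> 3 * real n" by simp
    show "norm (difference h \<phi> s) \<le> 3 * real n * W s" if h: "0 < h" "h < \<delta>" and s: "s \<in> J" for h s
    proof -
      obtain c where c: "c \<in> A n" "c + h \<in> A n" using \<eta>(2)[of h] h by (auto simp: \<delta>_def)
      have sh: "s + h \<in> J" using admissible_interval_shift[OF J s] h by simp
      have "norm (difference h \<phi> s) \<le> norm (difference (c + h) \<phi> s) + norm (difference c \<phi> (s + h))"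
        by (subst split[of h s c]) (rule norm_triangle_ineq4)
      also have "\<dots> \<le> real n * W s + real n * W (s + h)"
        using c s sh by (intro add_mono) (auto simp: A_def)
      also have "\<dots> \<le> real n * W s + real n * (2 * W s)"
        using W(3)[OF s, of h] h by (intro add_left_mono mult_left_mono) (auto simp: \<delta>_def)
      finally show ?thesis by simp
    qed
    show "norm (difference h \<phi> (s + k) - difference h \<phi> s) \<le> \<epsilon>"
      if h: "0 < h" "h < \<delta>" and k: "0 < k" "k < \<delta>" and s: "s \<in> J" for h k s
    proof -
      obtain c where c: "c \<in> A n" "c + h \<in> A n" using \<eta>(2)[of h] h by (auto simp: \<delta>_def)
      have sh: "s + h \<in> J" using admissible_interval_shift[OF J s] h by simp
      have "difference h \<phi> (s + k) - difference h \<phi> s =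
          (difference (c + h) \<phi> (s + k) - difference (c + h) \<phi> s) -
          (difference c \<phi> (s + h + k) - difference c \<phi> (s + h))"
        by (simp add: difference_apply algebra_simps)
      then have "norm (difference h \<phi> (s + k) - difference h \<phi> s) \<le>
          norm (difference (c + h) \<phi> (s + k) - difference (c + h) \<phi> s) +
          norm (difference c \<phi> (s + h + k) - difference c \<phi> (s + h))"
        by (simp only: norm_triangle_ineq4)
      also have "\<dots> \<le> \<epsilon> / 2 + \<epsilon> / 2"
        using c s sh k by (intro add_mono) (auto simp: A_def \<delta>_def)
      finally show ?thesis by simp
    qed
  qed
qed

text \<open>
  The uniform bounds improve to smallness by doubling the step:
  \<open>difference (2 * h) \<phi> s\<close> is twice \<open>difference h \<phi> s\<close> up to the second difference
  \<open>difference h \<phi> (s + h) - difference h \<phi> s\<close>, which has norm at most \<open>\<epsilon> / 2\<close> for small \<open>h\<close>. Each halving of the step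
  therefore halves the bound up to an error whose total is at most \<open>\<epsilon> / 2\<close>, and this error is
  absorbed because \<open>W \<ge> 1\<close>. The weights of interest are \<open>1\<close> and \<^const>\<open>weight\<close>.
\<close>
lemma differences_small:
  fixes \<phi> :: "real \<Rightarrow> 'a::banach"
  assumes J: "admissible_interval J" and \<phi>: "\<phi> \<in> L1_loc J"
    and W: "continuous_on J W" "\<And>s. s \<in> J \<Longrightarrow> 1 \<le> W s"
      "\<And>s t. s \<in> J \<Longrightarrow> 0 \<le> t \<Longrightarrow> t \<le> 1 \<Longrightarrow> W (s + t) \<le> 2 * W s"
    and "0 < e"
    and unif: "\<And>h. 0 < h \<Longrightarrow> h \<le> e \<Longrightarrow> uniformly_continuous_on J (difference h \<phi>)"
    and bdd: "\<And>h. 0 < h \<Longrightarrow> h \<le> e \<Longrightarrow> \<exists>b. \<forall>s\<in>J. norm (difference h \<phi> s) \<le> b * W s"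
    and "0 < \<epsilon>"
  obtains \<delta> where "0 < \<delta>"
    "\<And>h s. 0 < h \<Longrightarrow> h < \<delta> \<Longrightarrow> s \<in> J \<Longrightarrow> norm (difference h \<phi> s) \<le> \<epsilon> * W s"
proof -
  have W0: "0 \<le> W s" if "s \<in> J" for s using W(2)[OF that] by simp
  obtain \<delta> b where \<delta>: "0 < \<delta>" "0 \<le> b"
    and b: "\<And>h s. 0 < h \<Longrightarrow> h < \<delta> \<Longrightarrow> s \<in> J \<Longrightarrow> norm (difference h \<phi> s) \<le> b * W s"
    and osc: "\<And>h k s. 0 < h \<Longrightarrow> h < \<delta> \<Longrightarrow> 0 < k \<Longrightarrow> k < \<delta> \<Longrightarrow> s \<in> J \<Longrightarrow>
       norm (difference h \<phi> (s + k) - difference h \<phi> s) \<le> \<epsilon> / 2"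
    by (rule differences_locally_bounded[OF J \<phi> W(1) W0 W(3) \<open>0 < e\<close> unif bdd half_gt_zero[OF \<open>0 < \<epsilon>\<close>]];
        (assumption | (rule that; blast)))
  have halving: "norm (difference h \<phi> s) \<le> b / 2 ^ n * W s + \<epsilon> / 2"
    if "0 < h" "h * 2 ^ n < \<delta>" "s \<in> J" for n h s
    using that
  proof (induction n arbitrary: h)
    case 0
    then show ?case using b[of h s] \<open>0 < \<epsilon>\<close> by simp
  next
    case (Suc n)
    have "h * 1 \<le> h * 2 ^ Suc n"
      using Suc.prems(1) by (intro mult_left_mono one_le_power) auto
    then have h: "h < \<delta>" using Suc.prems(2) by simp
    have "2 *\<^sub>R difference h \<phi> s = difference (2 * h) \<phi> s - (difference h \<phi> (s + h) - difference h \<phi> s)"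
      by (simp add: difference_apply algebra_simps scaleR_2)
    then have "norm (2 *\<^sub>R difference h \<phi> s) \<le>
        norm (difference (2 * h) \<phi> s) + norm (difference h \<phi> (s + h) - difference h \<phi> s)"
      by (simp only: norm_triangle_ineq4)
    also have "\<dots> \<le> (b / 2 ^ n * W s + \<epsilon> / 2) + \<epsilon> / 2"
      using Suc.IH[of "2 * h"] Suc.prems osc[of h h s] h by (intro add_mono) (auto simp: mult_ac)
    finally show ?case by simp
  qed
  obtain n where n: "b / 2 ^ n < \<epsilon> / 2"
  proof -
    have "(\<lambda>n. b * (1 / 2) ^ n) \<longlonglongrightarrow> b * 0"
      by (intro tendsto_mult_left LIMSEQ_power_zero) simp
    then have "\<forall>\<^sub>F n in sequentially. b * (1 / 2) ^ n < \<epsilon> / 2"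
      using \<open>0 < \<epsilon>\<close> by (intro order_tendstoD) auto
    then show ?thesis using that by (auto simp: eventually_sequentially power_divide)
  qed
  show thesis
  proof (rule that[of "\<delta> / 2 ^ n"])
    show "0 < \<delta> / 2 ^ n" using \<delta>(1) by simp
    show "norm (difference h \<phi> s) \<le> \<epsilon> * W s" if h: "0 < h" "h < \<delta> / 2 ^ n" and s: "s \<in> J" for h s
    proof -
      have "norm (difference h \<phi> s) \<le> b / 2 ^ n * W s + \<epsilon> / 2 * 1"
        using halving[of h n s] h s by (simp add: pos_less_divide_eq)
      also have "\<dots> \<le> \<epsilon> / 2 * W s + \<epsilon> / 2 * W s"
        using n W(2)[OF s] W0[OF s] \<open>0 < \<epsilon>\<close> by (intro add_mono mult_right_mono mult_left_mono) auto
      finally show ?thesis by (simp add: algebra_simps)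
    qed
  qed
qed

section \<open>Uniform continuity and linear growth\<close>

lemma uniformly_continuous_if_differences_small:
  assumes "\<And>\<epsilon>. 0 < \<epsilon> \<Longrightarrow> \<exists>\<delta>>0. \<forall>h s. 0 < h \<longrightarrow> h < \<delta> \<longrightarrow> s \<in> J \<longrightarrow> s + h \<in> J \<longrightarrow> norm (f (s + h) - f s) < \<epsilon>"
  shows "uniformly_continuous_on J (f :: real \<Rightarrow> 'a::banach)"
  unfolding uniformly_continuous_on_def
proof (intro allI impI)
  fix \<epsilon> :: real assume "0 < \<epsilon>"
  then obtain \<delta> where \<delta>: "0 < \<delta>"
    "\<And>h s. 0 < h \<Longrightarrow> h < \<delta> \<Longrightarrow> s \<in> J \<Longrightarrow> s + h \<in> J \<Longrightarrow> norm (f (s + h) - f s) < \<epsilon>"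
    using assms by blast
  have "dist (f y) (f x) < \<epsilon>" if "x \<in> J" "y \<in> J" "dist y x < \<delta>" for x y
  proof (cases x y rule: linorder_cases)
    case less
    then show ?thesis using \<delta>(2)[of "y - x" x] that by (simp add: dist_norm)
  next
    case equal
    then show ?thesis using \<open>0 < \<epsilon>\<close> by simp
  next
    case greater
    then show ?thesis using \<delta>(2)[of "x - y" y] that by (simp add: dist_norm norm_minus_commute)
  qed
  then show "\<exists>\<delta>>0. \<forall>x\<in>J. \<forall>y\<in>J. dist y x < \<delta> \<longrightarrow> dist (f y) (f x) < \<epsilon>"
    using \<delta>(1) by blast
qed

text \<open>
  A shift by at most one is a chain of \<open>n + 1\<close> shifts that are short enough for the values to
  change by less than one.
\<close>
lemma uniformly_continuous_unit_shift_bounded: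
  fixes f :: "real \<Rightarrow> 'a::banach"
  assumes J: "admissible_interval J" and f: "uniformly_continuous_on J f"
  obtains M where "0 \<le> M" "\<And>s t. s \<in> J \<Longrightarrow> 0 \<le> t \<Longrightarrow> t \<le> 1 \<Longrightarrow> norm (f (s + t) - f s) \<le> M"
proof -
  obtain d where d: "0 < d" "\<And>x y. x \<in> J \<Longrightarrow> y \<in> J \<Longrightarrow> dist y x < d \<Longrightarrow> dist (f y) (f x) < 1"
    using f unfolding uniformly_continuous_on_def by (metis zero_less_one)
  obtain n :: nat where n: "1 / real (Suc n) < d" using nat_approx_posE[OF d(1)] by blast
  define r where "r = 1 / real (Suc n)"
  have r: "0 < r" "r < d" using n by (simp_all add: r_def)
  have step: "norm (f (s + t) - f s) \<le> real m" if "s \<in> J" "0 \<le> t" "t \<le> real m * r" for s t m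
    using that
  proof (induction m arbitrary: t)
    case 0
    then show ?case by simp
  next
    case (Suc m)
    show ?case
    proof (cases "t \<le> real m * r")
      case True
      then show ?thesis using Suc.IH[of t] Suc.prems by simp
    next
      case False
      let ?u = "real m * r"
      have u: "0 \<le> ?u" using r by simp
      have "dist (s + t) (s + ?u) < d"
        using False Suc.prems(3) r by (simp add: dist_norm algebra_simps)
      then have "norm (f (s + t) - f (s + ?u)) < 1"
        using d(2)[of "s + ?u" "s + t"] Suc.prems u admissible_interval_shift[OF J Suc.prems(1)]
        by (simp add: dist_norm)
      moreover have "norm (f (s + ?u) - f s) \<le> real m"
        using Suc.IH[of ?u] Suc.prems(1) u by simp
      moreover have "norm (f (s + t) - f s) \<le> norm (f (s + t) - f (s + ?u)) + norm (f (s + ?u) - f s)"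
        using norm_triangle_ineq[of "f (s + t) - f (s + ?u)" "f (s + ?u) - f s"] by simp
      ultimately show ?thesis by simp
    qed
  qed
  show thesis
  proof (rule that[of "real (Suc n)"])
    show "norm (f (s + t) - f s) \<le> real (Suc n)" if "s \<in> J" "0 \<le> t" "t \<le> 1" for s t
    proof -
      have "t \<le> real (Suc n) * r" using that(3) by (simp add: r_def)
      then show ?thesis by (rule step[OF that(1,2)])
    qed
  qed simp
qed

text \<open>
  Walking from a base point \<open>a\<close> to \<open>s\<close> takes at most \<open>\<bar>s - a\<bar> + 1\<close> steps of length at most one, each
  of which changes the value by a bounded amount. Thus \<^const>\<open>weight\<close> dominates every uniformly
  continuous function, which makes the norm of the third part finite and provides the bounds
  needed for the second part.
\<close>
lemma uniformly_continuous_linear_growth: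
  fixes f :: "real \<Rightarrow> 'a::banach"
  assumes J: "admissible_interval J" and f: "uniformly_continuous_on J f"
  obtains b where "0 \<le> b" "\<And>s. s \<in> J \<Longrightarrow> norm (f s) \<le> b * weight s"
proof -
  obtain M where M: "0 \<le> M" "\<And>s t. s \<in> J \<Longrightarrow> 0 \<le> t \<Longrightarrow> t \<le> 1 \<Longrightarrow> norm (f (s + t) - f s) \<le> M"
    using uniformly_continuous_unit_shift_bounded[OF J f] by blast
  have steps: "norm (f (s + t) - f s) \<le> real m * M" if "s \<in> J" "0 \<le> t" "t \<le> real m" for s t m
    using that
  proof (induction m arbitrary: s t)
    case 0
    then show ?case by simp
  next
    case (Suc m)
    show ?case
    proof (cases "t \<le> 1")
      case True
      have "M \<le> real (Suc m) * M" using M(1) by (simp add: mult_le_cancel_right1 algebra_simps)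
      then show ?thesis using M(2)[of s t] Suc.prems True by simp
    next
      case False
      have "norm (f (s + 1 + (t - 1)) - f (s + 1)) \<le> real m * M"
        using Suc.IH[of "s + 1" "t - 1"] Suc.prems False admissible_interval_shift[OF J Suc.prems(1), of 1]
        by simp
      moreover have "norm (f (s + 1) - f s) \<le> M" using M(2)[of s 1] Suc.prems by simp
      moreover have "norm (f (s + t) - f s) \<le> norm (f (s + t) - f (s + 1)) + norm (f (s + 1) - f s)"
        using norm_triangle_ineq[of "f (s + t) - f (s + 1)" "f (s + 1) - f s"] by simp
      ultimately show ?thesis by (simp add: algebra_simps)
    qed
  qed
  have dist: "norm (f y - f x) \<le> (y - x + 1) * M" if "x \<in> J" "x \<le> y" for x y
  proof -
    let ?m = "nat \<lceil>y - x\<rceil>"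
    have "norm (f (x + (y - x)) - f x) \<le> real ?m * M"
      using that by (intro steps) linarith+
    also have "\<dots> \<le> (y - x + 1) * M" using M(1) that by (intro mult_right_mono) linarith+
    finally show ?thesis by simp
  qed
  obtain a where a: "a \<in> J" using admissible_interval_nonempty[OF J] .
  show thesis
  proof (rule that[of "norm (f a) + (\<bar>a\<bar> + 1) * M"])
    show "0 \<le> norm (f a) + (\<bar>a\<bar> + 1) * M" using M(1) by simp
    fix s assume s: "s \<in> J"
    have "norm (f s - f a) \<le> (\<bar>s - a\<bar> + 1) * M"
      using dist[of a s] dist[of s a] a s by (cases "a \<le> s") (auto simp: norm_minus_commute)
    also have "\<dots> \<le> ((\<bar>a\<bar> + 1) * weight s) * M"
    proof (rule mult_right_mono[OF _ M(1)])
      have "0 \<le> \<bar>a\<bar> * \<bar>s\<bar>" by simp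
      then show "\<bar>s - a\<bar> + 1 \<le> (\<bar>a\<bar> + 1) * weight s"
        unfolding weight_def distrib_left distrib_right by linarith
    qed
    finally have "norm (f s - f a) \<le> (\<bar>a\<bar> + 1) * M * weight s" by (simp add: mult_ac)
    moreover have "norm (f a) * 1 \<le> norm (f a) * weight s"
      by (intro mult_left_mono) (auto simp: weight_def)
    moreover have "norm (f s) \<le> norm (f a) + norm (f s - f a)"
      using norm_triangle_ineq[of "f a" "f s - f a"] by simp
    ultimately show "norm (f s) \<le> (norm (f a) + (\<bar>a\<bar> + 1) * M) * weight s"
      by (simp add: algebra_simps)
  qed
qed

lemma sup_norm_le:
  assumes "\<And>s. s \<in> J \<Longrightarrow> norm (f s) \<le> c"
  shows "sup_norm J f \<le> ennreal c"
  unfolding sup_norm_def using assms by (intro SUP_least ennreal_leI) auto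

section \<open>Functions whose differences are uniformly continuous\<close>

lemma uniformly_continuous_if_differences_Cub:
  fixes \<phi> :: "real \<Rightarrow> 'a::banach"
  assumes J: "admissible_interval J" and \<phi>: "\<phi> \<in> L1_loc J" and e: "0 < e"
    and D: "\<And>h. 0 < h \<Longrightarrow> h \<le> e \<Longrightarrow> difference h \<phi> \<in> Cub J"
  shows "uniformly_continuous_on J \<phi>"
proof (rule uniformly_continuous_if_differences_small)
  fix \<epsilon> :: real assume "0 < \<epsilon>"
  have unif: "uniformly_continuous_on J (difference h \<phi>)" if "0 < h" "h \<le> e" for h
    using D[OF that] by (simp add: Cub_def Cu_def)
  have bdd: "\<exists>b. \<forall>s\<in>J. norm (difference h \<phi> s) \<le> b * 1" if "0 < h" "h \<le> e" for h
    using D[OF that] by (auto simp: Cub_def bounded_iff)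
  obtain \<delta> where "0 < \<delta>"
    "\<And>h s. 0 < h \<Longrightarrow> h < \<delta> \<Longrightarrow> s \<in> J \<Longrightarrow> norm (difference h \<phi> s) \<le> \<epsilon> / 2 * 1"
    by (rule differences_small[OF J \<phi> _ _ _ e unif bdd half_gt_zero[OF \<open>0 < \<epsilon>\<close>]])
      (auto intro!: continuous_intros)
  then show "\<exists>\<delta>>0. \<forall>h s. 0 < h \<longrightarrow> h < \<delta> \<longrightarrow> s \<in> J \<longrightarrow> s + h \<in> J \<longrightarrow> norm (\<phi> (s + h) - \<phi> s) < \<epsilon>"
    using \<open>0 < \<epsilon>\<close> by (force simp: difference_apply)
qed

lemma weighted_differences_tendsto_0:
  fixes \<phi> :: "real \<Rightarrow> 'a::banach"
  assumes J: "admissible_interval J" and \<phi>: "\<phi> \<in> L1_loc J"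
    and D: "\<And>h. 0 < h \<Longrightarrow> difference h \<phi> \<in> Cu J"
  shows "((\<lambda>h. sup_norm J (\<lambda>s. difference h \<phi> s /\<^sub>R weight s)) \<longlongrightarrow> 0) (at_right 0)"
proof (rule order_tendstoI)
  fix a :: ennreal assume "0 < a"
  then obtain c where c: "0 < c" "c < a" using dense by blast
  obtain \<epsilon> where \<epsilon>: "0 < \<epsilon>" "ennreal \<epsilon> < a"
    using c by (cases c) (auto simp: ennreal_less_zero_iff)
  have unif: "uniformly_continuous_on J (difference h \<phi>)" if "0 < h" for h
    using D[OF that] by (simp add: Cu_def)
  have bdd: "\<exists>b. \<forall>s\<in>J. norm (difference h \<phi> s) \<le> b * weight s" if "0 < h" for h
    by (rule uniformly_continuous_linear_growth[OF J unif[OF that]]) blast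
  obtain \<delta> where \<delta>: "0 < \<delta>"
    "\<And>h s. 0 < h \<Longrightarrow> h < \<delta> \<Longrightarrow> s \<in> J \<Longrightarrow> norm (difference h \<phi> s) \<le> \<epsilon> * weight s"
    by (rule differences_small[OF J \<phi> _ _ _ zero_less_one unif bdd \<epsilon>(1)])
      (auto simp: weight_def intro!: continuous_intros)
  have "sup_norm J (\<lambda>s. difference h \<phi> s /\<^sub>R weight s) < a" if h: "0 < h" "h < \<delta>" for h
  proof -
    have "sup_norm J (\<lambda>s. difference h \<phi> s /\<^sub>R weight s) \<le> ennreal \<epsilon>"
    proof (rule sup_norm_le)
      fix s assume "s \<in> J"
      then show "norm (difference h \<phi> s /\<^sub>R weight s) \<le> \<epsilon>"
        using \<delta>(2)[OF h, of s] by (simp add: weight_def field_simps)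
    qed
    then show ?thesis using \<epsilon>(2) by (rule order_le_less_trans)
  qed
  then show "\<forall>\<^sub>F h in at_right 0. sup_norm J (\<lambda>s. difference h \<phi> s /\<^sub>R weight s) < a"
    using \<delta>(1) unfolding eventually_at_right_field by blast
qed simp

section \<open>The norm on uniformly continuous functions\<close>

lemma sup_norm_upper: "s \<in> J \<Longrightarrow> ennreal (norm (f s)) \<le> sup_norm J f"
  unfolding sup_norm_def by (rule SUP_upper)

lemma sup_norm_add: "sup_norm J (\<lambda>s. f s + g s) \<le> sup_norm J f + sup_norm J g"
  unfolding sup_norm_def
proof (rule SUP_least)
  fix s assume s: "s \<in> J"
  have "ennreal (norm (f s + g s)) \<le> ennreal (norm (f s)) + ennreal (norm (g s))"
    by (simp add: norm_triangle_ineq flip: ennreal_plus)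
  also have "\<dots> \<le> (SUP s\<in>J. ennreal (norm (f s))) + (SUP s\<in>J. ennreal (norm (g s)))"
    using s by (intro add_mono SUP_upper)
  finally show "ennreal (norm (f s + g s)) \<le> \<dots>" .
qed

lemma sup_norm_scaleR: "sup_norm J (\<lambda>s. c *\<^sub>R f s) = ennreal \<bar>c\<bar> * sup_norm J f"
  by (simp add: sup_norm_def SUP_mult_left_ennreal ennreal_mult)

lemma u_norm_add: "u_norm J (f + g) \<le> u_norm J f + u_norm J g"
proof -
  have "sup_norm J (\<lambda>s. (f + g) s /\<^sub>R weight s) \<le>
      sup_norm J (\<lambda>s. f s /\<^sub>R weight s) + sup_norm J (\<lambda>s. g s /\<^sub>R weight s)"
    using sup_norm_add[of J "\<lambda>s. f s /\<^sub>R weight s" "\<lambda>s. g s /\<^sub>R weight s"]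
    by (simp add: scaleR_add_right)
  moreover have "(SUP t\<in>{0..1}. sup_norm J (\<lambda>s. (f + g) s - translate t (f + g) s)) \<le>
      (SUP t\<in>{0..1}. sup_norm J (\<lambda>s. f s - translate t f s)) +
      (SUP t\<in>{0..1}. sup_norm J (\<lambda>s. g s - translate t g s))"
  proof (rule SUP_least)
    fix t :: real assume t: "t \<in> {0..1}"
    have "sup_norm J (\<lambda>s. (f + g) s - translate t (f + g) s) \<le>
        sup_norm J (\<lambda>s. f s - translate t f s) + sup_norm J (\<lambda>s. g s - translate t g s)"
      using sup_norm_add[of J "\<lambda>s. f s - translate t f s" "\<lambda>s. g s - translate t g s"]
      by (simp add: translate_def algebra_simps)
    also have "\<dots> \<le> (SUP t\<in>{0..1}. sup_norm J (\<lambda>s. f s - translate t f s)) +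
      (SUP t\<in>{0..1}. sup_norm J (\<lambda>s. g s - translate t g s))"
      using t by (intro add_mono SUP_upper)
    finally show "sup_norm J (\<lambda>s. (f + g) s - translate t (f + g) s) \<le> \<dots>" .
  qed
  ultimately show ?thesis
    unfolding u_norm_def by (rule add_mono[THEN order_trans]) (simp add: ac_simps)
qed

lemma u_norm_scaleR: "u_norm J (\<lambda>s. c *\<^sub>R f s) = ennreal \<bar>c\<bar> * u_norm J f"
proof -
  have "sup_norm J (\<lambda>s. (c *\<^sub>R f s) /\<^sub>R weight s) = ennreal \<bar>c\<bar> * sup_norm J (\<lambda>s. f s /\<^sub>R weight s)"
    using sup_norm_scaleR[of J c "\<lambda>s. f s /\<^sub>R weight s"] by (simp add: mult.commute)
  moreover have "sup_norm J (\<lambda>s. c *\<^sub>R f s - translate t (\<lambda>s. c *\<^sub>R f s) s) =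
      ennreal \<bar>c\<bar> * sup_norm J (\<lambda>s. f s - translate t f s)" for t
    using sup_norm_scaleR[of J c "\<lambda>s. f s - translate t f s"]
    by (simp add: translate_def scaleR_diff_right)
  ultimately show ?thesis
    by (simp add: u_norm_def distrib_left SUP_mult_left_ennreal)
qed

lemma u_norm_minus: "u_norm J (f - g) = u_norm J (g - f)"
proof -
  have "f - g = (\<lambda>s. (- 1) *\<^sub>R (g - f) s)" by (auto simp: fun_eq_iff)
  then show ?thesis using u_norm_scaleR[of J "-1" "g - f"] by simp
qed

lemma weight_pos: "0 < weight s" by (simp add: weight_def)

text \<open>
  Together with the two lemmas \<open>norm_le_u_norm\<close> and \<open>shift_le_u_norm\<close> this reduces statements
  about the extended-valued norm to pointwise real inequalities.
\<close>
lemma u_norm_le: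
  assumes "0 \<le> a" "0 \<le> b"
    and "\<And>s. s \<in> J \<Longrightarrow> norm (f s) \<le> a * weight s"
    and "\<And>s t. s \<in> J \<Longrightarrow> 0 \<le> t \<Longrightarrow> t \<le> 1 \<Longrightarrow> norm (f s - f (s + t)) \<le> b"
  shows "u_norm J f \<le> ennreal (a + b)"
proof -
  have "sup_norm J (\<lambda>s. f s /\<^sub>R weight s) \<le> ennreal a"
    using assms(3) by (intro sup_norm_le) (simp add: weight_pos abs_of_pos field_simps)
  moreover have "(SUP t\<in>{0..1}. sup_norm J (\<lambda>s. f s - translate t f s)) \<le> ennreal b"
    using assms(4) by (intro SUP_least sup_norm_le) (simp add: translate_def)
  ultimately show ?thesis
    using assms(1,2) by (simp add: u_norm_def add_mono ennreal_plus)
qed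

lemma u_norm_finite:
  assumes J: "admissible_interval J" and f: "f \<in> Cu J"
  shows "u_norm J f < \<infinity>"
proof -
  have u: "uniformly_continuous_on J f" using f by (simp add: Cu_def)
  obtain b where b: "0 \<le> b" "\<And>s. s \<in> J \<Longrightarrow> norm (f s) \<le> b * weight s"
    using uniformly_continuous_linear_growth[OF J u] by blast
  obtain M where M: "0 \<le> M" "\<And>s t. s \<in> J \<Longrightarrow> 0 \<le> t \<Longrightarrow> t \<le> 1 \<Longrightarrow> norm (f (s + t) - f s) \<le> M"
    using uniformly_continuous_unit_shift_bounded[OF J u] by blast
  have "u_norm J f \<le> ennreal (b + M)"
    using b M by (intro u_norm_le) (auto simp: norm_minus_commute)
  then show ?thesis using order_le_less_trans by fastforce
qed

lemma
  assumes fin: "u_norm J f < \<infinity>" and s: "s \<in> J"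
  shows norm_le_u_norm: "norm (f s) \<le> enn2real (u_norm J f) * weight s"
    and shift_le_u_norm: "0 \<le> t \<Longrightarrow> t \<le> 1 \<Longrightarrow> norm (f s - f (s + t)) \<le> enn2real (u_norm J f)"
proof -
  have eq: "u_norm J f = ennreal (enn2real (u_norm J f))" using fin by simp
  have "ennreal (norm (f s /\<^sub>R weight s)) \<le> u_norm J f"
    unfolding u_norm_def using sup_norm_upper[OF s, of "\<lambda>s. f s /\<^sub>R weight s"]
    by (rule order_trans) simp
  then have "norm (f s /\<^sub>R weight s) \<le> enn2real (u_norm J f)"
    by (subst (asm) eq) simp
  then show "norm (f s) \<le> enn2real (u_norm J f) * weight s"
    using weight_pos[of s] by (simp add: field_simps)
  assume t: "0 \<le> t" "t \<le> 1"
  have "ennreal (norm (f s - translate t f s)) \<le> sup_norm J (\<lambda>s. f s - translate t f s)"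
    by (rule sup_norm_upper[OF s])
  also have "\<dots> \<le> (SUP t\<in>{0..1}. sup_norm J (\<lambda>s. f s - translate t f s))"
    using t by (intro SUP_upper) auto
  also have "\<dots> \<le> u_norm J f" by (simp add: u_norm_def)
  finally show "norm (f s - f (s + t)) \<le> enn2real (u_norm J f)"
    by (subst (asm) eq) (simp add: translate_def)
qed

section \<open>Completeness\<close>

lemma Cu_space_zero: "0 \<in> Cu_space J"
  by (simp add: Cu_space_def Cu_def zero_fun_def uniformly_continuous_on_const)

lemma Cu_space_add: "f \<in> Cu_space J \<Longrightarrow> g \<in> Cu_space J \<Longrightarrow> f + g \<in> Cu_space J"
  by (auto simp: Cu_space_def Cu_def plus_fun_def intro: uniformly_continuous_on_add)

lemma Cu_space_diff: "f \<in> Cu_space J \<Longrightarrow> g \<in> Cu_space J \<Longrightarrow> f - g \<in> Cu_space J"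
  by (auto simp: Cu_space_def Cu_def fun_diff_def intro: uniformly_continuous_on_diff)

lemma Cu_space_scaleR: "f \<in> Cu_space J \<Longrightarrow> (\<lambda>s. c *\<^sub>R f s) \<in> Cu_space J"
  by (auto simp: Cu_space_def Cu_def intro: uniformly_continuous_on_cmul)

lemma Cu_space_u_norm_finite:
  "admissible_interval J \<Longrightarrow> f \<in> Cu_space J \<Longrightarrow> u_norm J f < \<infinity>"
  using u_norm_finite[of J f] by (simp add: Cu_space_def)

lemma u_norm_eq_0_iff:
  assumes J: "admissible_interval J" and f: "f \<in> Cu_space J"
  shows "enn2real (u_norm J f) = 0 \<longleftrightarrow> f = 0"
proof
  assume 0: "enn2real (u_norm J f) = 0"
  have "f s = 0" for s
    using norm_le_u_norm[OF Cu_space_u_norm_finite[OF J f], of s] f 0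
    by (cases "s \<in> J") (auto simp: Cu_space_def)
  then show "f = 0" by (simp add: fun_eq_iff)
next
  assume "f = 0"
  then have "u_norm J f \<le> ennreal (0 + 0)" by (intro u_norm_le) auto
  then show "enn2real (u_norm J f) = 0" by simp
qed

lemma u_norm_triangle:
  assumes J: "admissible_interval J" and "f \<in> Cu_space J" "g \<in> Cu_space J"
  shows "enn2real (u_norm J (f + g)) \<le> enn2real (u_norm J f) + enn2real (u_norm J g)"
proof -
  have fin: "u_norm J f < \<infinity>" "u_norm J g < \<infinity>"
    using assms(2,3) by (auto intro: Cu_space_u_norm_finite[OF J] simp del: infinity_ennreal_def)
  then have "u_norm J f + u_norm J g < top" by (simp add: ennreal_add_less_top)
  then have "enn2real (u_norm J (f + g)) \<le> enn2real (u_norm J f + u_norm J g)"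
    using u_norm_add by (rule enn2real_mono[rotated])
  also have "\<dots> = enn2real (u_norm J f) + enn2real (u_norm J g)"
    using fin by (simp add: enn2real_plus)
  finally show ?thesis .
qed

lemma Cu_space_Metric_space:
  assumes J: "admissible_interval J"
  shows "Metric_space (Cu_space J :: (real \<Rightarrow> 'a::banach) set) (\<lambda>f g. enn2real (u_norm J (f - g)))"
proof
  fix f g :: "real \<Rightarrow> 'a"
  show "0 \<le> enn2real (u_norm J (f - g))" by simp
  show "enn2real (u_norm J (f - g)) = enn2real (u_norm J (g - f))" by (subst u_norm_minus) (rule refl)
next
  fix f g :: "real \<Rightarrow> 'a" assume "f \<in> Cu_space J" "g \<in> Cu_space J"
  then show "enn2real (u_norm J (f - g)) = 0 \<longleftrightarrow> f = g"
    using u_norm_eq_0_iff[OF J Cu_space_diff, of f g] by simp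
next
  fix f g k :: "real \<Rightarrow> 'a" assume "f \<in> Cu_space J" "g \<in> Cu_space J" "k \<in> Cu_space J"
  then show "enn2real (u_norm J (f - k)) \<le> enn2real (u_norm J (f - g)) + enn2real (u_norm J (g - k))"
    using u_norm_triangle[OF J Cu_space_diff Cu_space_diff, of f g g k] by simp
qed

text \<open>
  A Cauchy sequence converges pointwise, by completeness of the range. Pointwise inequalities pass to
  the limit, so both parts of the norm of \<open>F n - f\<close> become small. The shift part is what makes
  \<open>f\<close> uniformly continuous: \<open>f\<close> differs from a uniformly continuous \<open>F n\<close> by a function whose unit
  shifts are small, although \<open>F n\<close> need not be uniformly close to \<open>f\<close>.
\<close>
lemma Cu_space_mcomplete:
  assumes J: "admissible_interval J"
  shows "Metric_space.mcomplete (Cu_space J :: (real \<Rightarrow> 'a::banach) set) (\<lambda>f g. enn2real (u_norm J (f - g)))"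
proof -
  interpret Metric_space "Cu_space J :: (real \<Rightarrow> 'a) set" "\<lambda>f g. enn2real (u_norm J (f - g))"
    by (rule Cu_space_Metric_space[OF J])
  show ?thesis
    unfolding mcomplete_def
  proof (intro allI impI)
    fix F :: "nat \<Rightarrow> real \<Rightarrow> 'a" assume "MCauchy F"
    then have F: "F n \<in> Cu_space J" for n by (auto simp: MCauchy_def)
    have small: "\<exists>N. \<forall>n\<ge>N. \<forall>m\<ge>N. enn2real (u_norm J (F n - F m)) < \<epsilon>" if "0 < \<epsilon>" for \<epsilon>
      using \<open>MCauchy F\<close> that by (auto simp: MCauchy_def)
    have fin: "u_norm J (F n - F m) < \<infinity>" for n m
      by (intro Cu_space_u_norm_finite[OF J] Cu_space_diff F)
    have "convergent (\<lambda>n. F n s)" for s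
    proof (cases "s \<in> J")
      case True
      have "Cauchy (\<lambda>n. F n s)"
      proof (rule CauchyI)
        fix \<epsilon> :: real assume "0 < \<epsilon>"
        then have "0 < \<epsilon> / weight s" using weight_pos by simp
        then obtain N where N: "\<And>n m. n \<ge> N \<Longrightarrow> m \<ge> N \<Longrightarrow> enn2real (u_norm J (F n - F m)) < \<epsilon> / weight s"
          using small by blast
        have "norm (F m s - F n s) < \<epsilon>" if "m \<ge> N" "n \<ge> N" for m n
          using norm_le_u_norm[OF fin True, of m n] N[OF that] weight_pos[of s]
          by (simp add: pos_less_divide_eq)
        then show "\<exists>N. \<forall>m\<ge>N. \<forall>n\<ge>N. norm (F m s - F n s) < \<epsilon>" by blast
      qed
      then show ?thesis by (rule Cauchy_convergent)
    next
      case False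
      then have "F n s = 0" for n using F[of n] by (simp add: Cu_space_def)
      then show ?thesis by (simp add: convergent_const)
    qed
    then obtain f where f: "\<And>s. (\<lambda>n. F n s) \<longlonglongrightarrow> f s"
      unfolding convergent_def by metis
    have close: "\<exists>N. \<forall>n\<ge>N. (\<forall>s\<in>J. norm (F n s - f s) \<le> \<epsilon> * weight s) \<and>
        (\<forall>s\<in>J. \<forall>t\<in>{0..1}. norm ((F n s - f s) - (F n (s + t) - f (s + t))) \<le> \<epsilon>)"
      if "0 < \<epsilon>" for \<epsilon>
    proof -
      obtain N where N: "\<And>n m. n \<ge> N \<Longrightarrow> m \<ge> N \<Longrightarrow> enn2real (u_norm J (F n - F m)) < \<epsilon>"
        using small[OF \<open>0 < \<epsilon>\<close>] by blast
      have "norm (F n s - f s) \<le> \<epsilon> * weight s" if "n \<ge> N" "s \<in> J" for n s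
      proof (rule Lim_bounded)
        show "(\<lambda>m. norm (F n s - F m s)) \<longlonglongrightarrow> norm (F n s - f s)"
          by (intro tendsto_intros f)
        show "\<forall>m\<ge>N. norm (F n s - F m s) \<le> \<epsilon> * weight s"
        proof (intro allI impI)
          fix m assume "m \<ge> N"
          then have "enn2real (u_norm J (F n - F m)) * weight s \<le> \<epsilon> * weight s"
            using N[OF that(1)] weight_pos[of s] by (intro mult_right_mono) (auto intro: less_imp_le)
          then show "norm (F n s - F m s) \<le> \<epsilon> * weight s"
            using norm_le_u_norm[OF fin that(2), of n m] by simp
        qed
      qed
      moreover have "norm ((F n s - f s) - (F n (s + t) - f (s + t))) \<le> \<epsilon>"
        if "n \<ge> N" "s \<in> J" "t \<in> {0..1}" for n s t
      proof (rule Lim_bounded)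
        show "(\<lambda>m. norm ((F n s - F m s) - (F n (s + t) - F m (s + t)))) \<longlonglongrightarrow>
            norm ((F n s - f s) - (F n (s + t) - f (s + t)))"
          by (intro tendsto_intros f)
        show "\<forall>m\<ge>N. norm ((F n s - F m s) - (F n (s + t) - F m (s + t))) \<le> \<epsilon>"
        proof (intro allI impI)
          fix m assume "m \<ge> N"
          then show "norm ((F n s - F m s) - (F n (s + t) - F m (s + t))) \<le> \<epsilon>"
            using shift_le_u_norm[OF fin that(2), of t n m] that(3) N[OF that(1), of m] by simp
        qed
      qed
      ultimately show ?thesis by blast
    qed
    have "uniformly_continuous_on J f"
    proof (rule uniformly_continuous_if_differences_small)
      fix \<epsilon> :: real assume "0 < \<epsilon>"
      then obtain n where n: "\<And>s t. s \<in> J \<Longrightarrow> t \<in> {0..1} \<Longrightarrow>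
          norm ((F n s - f s) - (F n (s + t) - f (s + t))) \<le> \<epsilon> / 2"
        using close[OF half_gt_zero[OF \<open>0 < \<epsilon>\<close>]] by (meson order_refl)
      have "uniformly_continuous_on J (F n)" using F[of n] by (simp add: Cu_space_def Cu_def)
      then obtain d where d: "0 < d" "\<And>x y. x \<in> J \<Longrightarrow> y \<in> J \<Longrightarrow> dist y x < d \<Longrightarrow> dist (F n y) (F n x) < \<epsilon> / 2"
        using \<open>0 < \<epsilon>\<close> unfolding uniformly_continuous_on_def by (metis half_gt_zero)
      have "norm (f (s + h) - f s) < \<epsilon>" if "0 < h" "h < min d 1" "s \<in> J" "s + h \<in> J" for h s
      proof -
        have "norm (F n (s + h) - F n s) < \<epsilon> / 2"
          using d(2)[of s "s + h"] that by (simp add: dist_norm)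
        moreover have "norm ((F n s - f s) - (F n (s + h) - f (s + h))) \<le> \<epsilon> / 2"
          using n[of s h] that by simp
        moreover have "f (s + h) - f s =
            ((F n s - f s) - (F n (s + h) - f (s + h))) + (F n (s + h) - F n s)" by simp
        then have "norm (f (s + h) - f s) \<le>
            norm ((F n s - f s) - (F n (s + h) - f (s + h))) + norm (F n (s + h) - F n s)"
          by (simp only: norm_triangle_ineq)
        ultimately show ?thesis by linarith
      qed
      then show "\<exists>\<delta>>0. \<forall>h s. 0 < h \<longrightarrow> h < \<delta> \<longrightarrow> s \<in> J \<longrightarrow> s + h \<in> J \<longrightarrow> norm (f (s + h) - f s) < \<epsilon>"
        using d(1) by (intro exI[of _ "min d 1"]) simp
    qed
    moreover have "f s = 0" if "s \<notin> J" for s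
    proof (rule LIMSEQ_unique[OF f])
      have "F n s = 0" for n using F[of n] that by (simp add: Cu_space_def)
      then show "(\<lambda>n. F n s) \<longlonglongrightarrow> 0" by simp
    qed
    ultimately have fC: "f \<in> Cu_space J" by (simp add: Cu_space_def Cu_def)
    have "\<exists>N. \<forall>n\<ge>N. F n \<in> Cu_space J \<and> enn2real (u_norm J (F n - f)) < \<epsilon>" if "0 < \<epsilon>" for \<epsilon>
    proof -
      obtain N where N: "\<And>n s. n \<ge> N \<Longrightarrow> s \<in> J \<Longrightarrow> norm (F n s - f s) \<le> \<epsilon> / 3 * weight s"
        "\<And>n s t. n \<ge> N \<Longrightarrow> s \<in> J \<Longrightarrow> t \<in> {0..1} \<Longrightarrow>
          norm ((F n s - f s) - (F n (s + t) - f (s + t))) \<le> \<epsilon> / 3"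
        using close[OF divide_pos_pos[OF \<open>0 < \<epsilon>\<close> zero_less_numeral]] by meson
      have "enn2real (u_norm J (F n - f)) < \<epsilon>" if "n \<ge> N" for n
      proof -
        have "u_norm J (F n - f) \<le> ennreal (\<epsilon> / 3 + \<epsilon> / 3)"
          using N[OF that] \<open>0 < \<epsilon>\<close> by (intro u_norm_le) auto
        then have "enn2real (u_norm J (F n - f)) \<le> \<epsilon> / 3 + \<epsilon> / 3"
          using \<open>0 < \<epsilon>\<close> by (intro enn2real_leI) auto
        then show ?thesis using \<open>0 < \<epsilon>\<close> by simp
      qed
      then show ?thesis using F by blast
    qed
    with fC have "limitin mtopology F f sequentially"
      by (simp add: limit_metric_sequentially)
    then show "\<exists>f. limitin mtopology F f sequentially" by blast
  qed
qed

lemma Cu_space_banach: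
  assumes J: "admissible_interval J"
  shows "banach_space_on (Cu_space J :: (real \<Rightarrow> 'a::banach) set)
            (\<lambda>c f s. c *\<^sub>R f s) (\<lambda>f. enn2real (u_norm J f))"
proof -
  interpret vector_space "\<lambda>c (f :: real \<Rightarrow> 'a) s. c *\<^sub>R f s"
    by standard (auto simp: fun_eq_iff scaleR_add_right scaleR_add_left)
  have "subspace (Cu_space J)"
    by (intro subspaceI Cu_space_zero Cu_space_add Cu_space_scaleR)
  then show ?thesis
    unfolding banach_space_on_def
    by (intro conjI ballI allI vector_space_axioms Cu_space_Metric_space[OF J] Cu_space_mcomplete[OF J]
        u_norm_eq_0_iff[OF J] u_norm_triangle[OF J])
      (simp_all add: u_norm_scaleR enn2real_mult)
qed

theorem proposition1p7:
  fixes J :: "real set"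
  assumes "admissible_interval J"
  shows "(\<forall>\<phi> :: real \<Rightarrow> 'a::banach. \<forall>\<epsilon>\<^sub>0 > 0.
            \<phi> \<in> L1_loc J \<longrightarrow> (\<forall>h. 0 < h \<and> h \<le> \<epsilon>\<^sub>0 \<longrightarrow> difference h \<phi> \<in> Cub J) \<longrightarrow>
            uniformly_continuous_on J \<phi>)
       \<and> (\<forall>\<phi> :: real \<Rightarrow> 'a.
            \<phi> \<in> L1_loc J \<longrightarrow> (\<forall>h>0. difference h \<phi> \<in> Cu J) \<longrightarrow>
            ((\<lambda>h. sup_norm J (\<lambda>s. difference h \<phi> s /\<^sub>R weight s)) \<longlongrightarrow> 0) (at_right 0))
       \<and> (\<forall>f \<in> (Cu_space J :: (real \<Rightarrow> 'a) set). u_norm J f < \<infinity>)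
       \<and> banach_space_on (Cu_space J :: (real \<Rightarrow> 'a) set)
            (\<lambda>c f s. c *\<^sub>R f s) (\<lambda>f. enn2real (u_norm J f))"
proof (intro conjI allI ballI impI)
  fix \<phi> :: "real \<Rightarrow> 'a" and \<epsilon>\<^sub>0 :: real
  assume "0 < \<epsilon>\<^sub>0" "\<phi> \<in> L1_loc J" "\<forall>h. 0 < h \<and> h \<le> \<epsilon>\<^sub>0 \<longrightarrow> difference h \<phi> \<in> Cub J"
  then show "uniformly_continuous_on J \<phi>" by (intro uniformly_continuous_if_differences_Cub[OF assms]) auto
next
  fix \<phi> :: "real \<Rightarrow> 'a"
  assume "\<phi> \<in> L1_loc J" "\<forall>h>0. difference h \<phi> \<in> Cu J"
  then show "((\<lambda>h. sup_norm J (\<lambda>s. difference h \<phi> s /\<^sub>R weight s)) \<longlongrightarrow> 0) (at_right 0)"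
    by (intro weighted_differences_tendsto_0[OF assms]) auto
next
  fix f :: "real \<Rightarrow> 'a" assume "f \<in> Cu_space J"
  then show "u_norm J f < \<infinity>" by (rule Cu_space_u_norm_finite[OF assms])
next
  show "banach_space_on (Cu_space J :: (real \<Rightarrow> 'a) set)
            (\<lambda>c f s. c *\<^sub>R f s) (\<lambda>f. enn2real (u_norm J f))"
    by (rule Cu_space_banach[OF assms])
qed

end
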